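(* Let $\mathbf{x}(\cdot)=(x_1(\cdot),\dots,x_N(\cdot))$ and $\lambda(\cdot)$ be twice continuously differentiable curves on $\mathbb{T}$ with values in $(\mathbb{R}^n)^N$ and $\mathbb{R}^m$, and put $z_i=x_i+e^{-a_t}\dot x_i$, $z_{\mathbf{x}}=(z_1,\dots,z_N)$, $z_\lambda=\lambda+e^{-a_t}\dot\lambda$. Assume the ideal scaling $\dot g_t=e^{a_t}$, $\dot b_t\le e^{a_t}$. Then the Euler--Lagrange equations $$\frac{d}{dt}\frac{\partial \mathbb{L}_{\mathbf{x}}}{\partial \dot x_i}-\frac{\partial \mathbb{L}_{\mathbf{x}}}{\partial x_i}=0\quad (i=1,\dots,N),\qquad \frac{d}{dt}\frac{\partial \mathbb{L}_{\lambda}}{\partial \dot \lambda}-\frac{\partial \mathbb{L}_{\lambda}}{\partial \lambda}=0$$ of the augmented Bregman Lagrangians $\mathbb{L}_{\mathbf{x}}$ and $\mathbb{L}_\lambda$ (defined in the context) are the second-order ODEs $$\ddot x_i+(e^{a_t}-\dot a_t)\dot x_i+e^{2a_t+b_t}[\nabla^2\phi_i(z_i)]^{-1}\nabla_{x_i}\mathcal{L}_\mu(\mathbf{x},z_\lambda)=0,\quad i=1,\dots,N,$$ $$\ddot\lambda+(e^{a_t}-\dot a_t)\dot\lambda-e^{2a_t+b_t}[\nabla^2\Phi_\lambda(z_\lambda)]^{-1}\nabla_\lambda\mathcal{L}_\mu(z_{\mathbf{x}},\lambda)=0.$$ Moreover, setting $u_i=\nabla\phi_i(z_i)$ and $u_\lambda=\nabla\Phi_\lambda(z_\lambda)$,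 these second-order ODEs yield the first-order ODEs $$\dot x_i=e^{a_t}[\nabla\phi_i^*(u_i)-x_i],\qquad \dot u_i=-e^{a_t+b_t}\nabla_{x_i}\mathcal{L}_\mu(\mathbf{x},z_\lambda),\quad i=1,\dots,N,$$ $$\dot\lambda=e^{a_t}[\nabla\Phi_\lambda^*(u_\lambda)-\lambda],\qquad \dot u_\lambda=e^{a_t+b_t}\nabla_\lambda\mathcal{L}_\mu(z_{\mathbf{x}},\lambda).$$
   Context: Let $N,n,m\ge 1$; $f_i:\mathbb{R}^n\to\mathbb{R}$ ($i=1,\dots,N$) convex and continuously differentiable; $A_i\in\mathbb{R}^{m\times n}$, $C\in\mathbb{R}^m$. For $\mathbf{x}=(x_1,\dots,x_N)\in(\mathbb{R}^n)^N$ let $F(\mathbf{x})=\sum_{i=1}^N f_i(x_i)$, $r(\mathbf{x})=\sum_{i=1}^N A_ix_i-C$. For $\mu>0$ the augmented Lagrangian is $\mathcal{L}_\mu(\mathbf{x},\lambda)=F(\mathbf{x})+\langle\lambda,r(\mathbf{x})\rangle+\frac{\mu}{2}\|r(\mathbf{x})\|^2$, $\lambda\in\mathbb{R}^m$. The functions $\phi_i:\mathbb{R}^n\to\mathbb{R}$ and $\Phi_\lambda:\mathbb{R}^m\to\mathbb{R}$ are strongly convex and twice (continuously) differentiable; $\Phi_x(\mathbf{x})=\sum_i\phi_i(x_i)$. The Bregman divergence of $\phi$ is $D_\phi(y,x)=\phi(y)-\phi(x)-\langle\nabla\phi(x),y-x\rangle$. A superscript $*$ on $\phi_i,\Phi_\lambda$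 denotes the convex (Fenchel) conjugate. $\mathbb{T}$ is a time interval and $a_t,b_t,g_t:\mathbb{T}\to\mathbb{R}$ are continuously differentiable. The augmented Bregman Lagrangians are $$\mathbb{L}_{\mathbf{x}}(\mathbf{x},\dot{\mathbf{x}},t)=e^{a_t+g_t}\big[D_{\Phi_x}(\mathbf{x}+e^{-a_t}\dot{\mathbf{x}},\mathbf{x})-e^{b_t}\mathcal{L}_\mu(\mathbf{x},z_\lambda)\big],$$ $$\mathbb{L}_\lambda(\lambda,\dot\lambda,t)=e^{a_t+g_t}\big[D_{\Phi_\lambda}(\lambda+e^{-a_t}\dot\lambda,\lambda)+e^{b_t}\mathcal{L}_\mu(z_{\mathbf{x}},\lambda)\big].$$ In $\mathbb{L}_{\mathbf{x}}$ the variable $z_\lambda$ is held fixed under variation (i.e. treated as a given function of $t$ when computing the partial derivatives with respect to $x_i,\dot x_i$), and in $\mathbb{L}_\lambda$ the variable $z_{\mathbf{x}}$ is held fixed under variation. *)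

theory Defs
  imports "HOL-Analysis.Analysis"
begin

definition grad :: "('a::euclidean_space \<Rightarrow> real) \<Rightarrow> 'a \<Rightarrow> 'a" where
  "grad f x = (THE D. GDERIV f x :> D)"

definition block_grad :: "'k::finite \<Rightarrow> ((real^'n)^'k \<Rightarrow> real) \<Rightarrow> (real^'n)^'k \<Rightarrow> real^'n" where
  "block_grad i F x = grad (\<lambda>y. F (\<chi> j. if j = i then y else x $ j)) (x $ i)"

definition hessian :: "(real^'n \<Rightarrow> real) \<Rightarrow> real^'n \<Rightarrow> real^'n^'n" where
  "hessian f x = jacobian (grad f) (at x)"

definition continuously_differentiable :: "('a::euclidean_space \<Rightarrow> real) \<Rightarrow> bool" where
  "continuously_differentiable f \<longleftrightarrow> (\<forall>x. f differentiable (at x)) \<and> continuous_on UNIV (grad f)"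

definition twice_differentiable :: "('a::euclidean_space \<Rightarrow> real) \<Rightarrow> bool" where
  "twice_differentiable f \<longleftrightarrow> (\<forall>x. f differentiable (at x)) \<and> (\<forall>x. grad f differentiable (at x))"

definition strongly_convex :: "('a::euclidean_space \<Rightarrow> real) \<Rightarrow> bool" where
  "strongly_convex f \<longleftrightarrow> (\<exists>\<sigma>>0. \<forall>x y. \<forall>\<theta>\<in>{0..1}.
     f ((1 - \<theta>) *\<^sub>R x + \<theta> *\<^sub>R y)
       \<le> (1 - \<theta>) * f x + \<theta> * f y - \<sigma> / 2 * \<theta> * (1 - \<theta>) * (norm (x - y))\<^sup>2)"

definition bregman_div :: "('a::euclidean_space \<Rightarrow> real) \<Rightarrow> 'a \<Rightarrow> 'a \<Rightarrow> real" where
  "bregman_div f y x = f y - f x - inner (grad f x) (y - x)"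

text \<open>
  The Fenchel conjugate. It is a real-valued supremum, hence only meaningful where the
  supremum is finite; for a strongly convex \<open>f\<close> defined on the whole space this is everywhere.
\<close>

definition fenchel_conj :: "('a::euclidean_space \<Rightarrow> real) \<Rightarrow> 'a \<Rightarrow> real" where
  "fenchel_conj f y = (SUP x. inner y x - f x)"

text \<open>
  Derivatives are taken within \<open>T\<close>, so that they are one-sided at those endpoints
  that belong to \<open>T\<close>.
\<close>

definition tderiv :: "real set \<Rightarrow> (real \<Rightarrow> 'a::real_normed_vector) \<Rightarrow> real \<Rightarrow> 'a" where
  "tderiv T q t = vector_derivative q (at t within T)"

definition C1_curve :: "real set \<Rightarrow> (real \<Rightarrow> 'a::real_normed_vector) \<Rightarrow> bool" where
  "C1_curve T q \<longleftrightarrow> (\<forall>t\<in>T. q differentiable (at t within T)) \<and> continuous_on T (tderiv T q)"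

definition C2_curve :: "real set \<Rightarrow> (real \<Rightarrow> 'a::real_normed_vector) \<Rightarrow> bool" where
  "C2_curve T q \<longleftrightarrow> C1_curve T q \<and> C1_curve T (tderiv T q)"

text \<open>
  A Lagrangian is a function \<open>L q v t\<close> of position, velocity and time. The equation at time \<open>t\<close>
  includes the assertion that the momentum \<open>\<partial>L/\<partial>v\<close> is differentiable along the curve at \<open>t\<close>.
\<close>

definition euler_lagrange ::
  "real set \<Rightarrow> ('a::euclidean_space \<Rightarrow> 'a \<Rightarrow> real \<Rightarrow> real) \<Rightarrow> (real \<Rightarrow> 'a) \<Rightarrow> real \<Rightarrow> bool" where
  "euler_lagrange T L q t \<longleftrightarrow>
     (let p = (\<lambda>s. grad (\<lambda>v. L (q s) v s) (tderiv T q s)) in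
       p differentiable (at t within T) \<and>
       tderiv T p t - grad (\<lambda>y. L y (tderiv T q t) t) (q t) = 0)"

definition euler_lagrange_block ::
  "real set \<Rightarrow> ((real^'n)^'k::finite \<Rightarrow> (real^'n)^'k \<Rightarrow> real \<Rightarrow> real) \<Rightarrow> (real \<Rightarrow> (real^'n)^'k)
     \<Rightarrow> 'k \<Rightarrow> real \<Rightarrow> bool" where
  "euler_lagrange_block T L q i t \<longleftrightarrow>
     (let p = (\<lambda>s. block_grad i (\<lambda>v. L (q s) v s) (tderiv T q s)) in
       p differentiable (at t within T) \<and>
       tderiv T p t - block_grad i (\<lambda>y. L y (tderiv T q t) t) (q t) = 0)"

definition residual ::
  "('k::finite \<Rightarrow> real^'n^'m) \<Rightarrow> real^'m \<Rightarrow> (real^'n)^'k \<Rightarrow> real^'m" where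
  "residual A C x = (\<Sum>i\<in>UNIV. A i *v (x $ i)) - C"

definition separable_sum :: "('k::finite \<Rightarrow> real^'n \<Rightarrow> real) \<Rightarrow> (real^'n)^'k \<Rightarrow> real" where
  "separable_sum f x = (\<Sum>i\<in>UNIV. f i (x $ i))"

definition aug_lagrangian ::
  "('k::finite \<Rightarrow> real^'n \<Rightarrow> real) \<Rightarrow> ('k \<Rightarrow> real^'n^'m) \<Rightarrow> real^'m \<Rightarrow> real
     \<Rightarrow> (real^'n)^'k \<Rightarrow> real^'m \<Rightarrow> real" where
  "aug_lagrangian f A C \<mu> x l =
     separable_sum f x + inner l (residual A C x) + \<mu> / 2 * (norm (residual A C x))\<^sup>2"

text \<open>
  In both Bregman Lagrangians the curve of the respective other variable enters as a given
  function of time (\<open>zl\<close>, \<open>zx\<close>) and not through position or velocity; this is what it means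
  for it to be held fixed under variation. The argument \<open>\<L>\<close> is the augmented Lagrangian.
\<close>

definition bregman_lagrangian_x ::
  "('a::euclidean_space \<Rightarrow> real) \<Rightarrow> ('a \<Rightarrow> 'b \<Rightarrow> real)
     \<Rightarrow> (real \<Rightarrow> real) \<Rightarrow> (real \<Rightarrow> real) \<Rightarrow> (real \<Rightarrow> real) \<Rightarrow> (real \<Rightarrow> 'b)
     \<Rightarrow> 'a \<Rightarrow> 'a \<Rightarrow> real \<Rightarrow> real" where
  "bregman_lagrangian_x \<Phi> \<L> a b g zl x v t =
     exp (a t + g t) *
       (bregman_div \<Phi> (x + exp (- a t) *\<^sub>R v) x - exp (b t) * \<L> x (zl t))"

definition bregman_lagrangian_dual ::
  "('b::euclidean_space \<Rightarrow> real) \<Rightarrow> ('a \<Rightarrow> 'b \<Rightarrow> real)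
     \<Rightarrow> (real \<Rightarrow> real) \<Rightarrow> (real \<Rightarrow> real) \<Rightarrow> (real \<Rightarrow> real) \<Rightarrow> (real \<Rightarrow> 'a)
     \<Rightarrow> 'b \<Rightarrow> 'b \<Rightarrow> real \<Rightarrow> real" where
  "bregman_lagrangian_dual \<Phi> \<L> a b g zx l v t =
     exp (a t + g t) *
       (bregman_div \<Phi> (l + exp (- a t) *\<^sub>R v) l + exp (b t) * \<L> (zx t) l)"

end

theory Submission
  imports Defs
begin

text \<open>
  The momentum of each Bregman Lagrangian is \<open>p = e\<^sup>g (\<nabla>\<phi>(z) - \<nabla>\<phi>(q))\<close>. The derivative of the
  Lagrangian with respect to the position contains \<open>\<nabla>\<^sup>2\<phi>(q)\<close> transposed; as \<open>\<nabla>\<phi>\<close> is only assumed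
  differentiable, the Hessian need not be continuous, but it is symmetric by Young's theorem. Under
  \<open>g' = e\<^sup>a\<close> the Euler--Lagrange equation therefore collapses to \<open>\<nabla>\<^sup>2\<phi>(z) z' = - e\<^sup>a W\<close>, where \<open>W\<close>
  is \<open>e\<^sup>b\<close> times the (signed) gradient of the augmented Lagrangian. Strong convexity makes the
  Hessian invertible, which gives the second-order equation; and \<open>\<nabla>\<^sup>2\<phi>(z) z'\<close> is the time derivative
  of \<open>u = \<nabla>\<phi>(z)\<close>, while \<open>\<nabla>\<phi>\<^sup>*(u) = z\<close> turns the definition of \<open>z\<close> into the equation for \<open>q'\<close>.
\<close>

section \<open>Gradients and Hessians as Frechet derivatives\<close>

text \<open>\<open>grad\<close> is a definite description, so it takes uniqueness of the Frechet
  derivative to identify it; explicit gradients further on are obtained by exhibiting a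
  \<open>GDERIV\<close> and applying this rule.\<close>

lemma grad_eqI: "GDERIV f x :> D \<Longrightarrow> grad f x = D"
  unfolding grad_def
proof (rule the_equality)
  fix D' assume "GDERIV f x :> D" "GDERIV f x :> D'"
  then have "(\<lambda>h. inner h D) = (\<lambda>h. inner h D')"
    unfolding gderiv_def by (rule has_derivative_unique)
  then show "D' = D"
    by (metis inner_commute vector_eq_ldot)
qed

lemma differentiable_imp_GDERIV_grad:
  fixes f :: "'a::euclidean_space \<Rightarrow> real"
  assumes "f differentiable (at x)"
  shows "GDERIV f x :> grad f x"
proof -
  obtain f' where f': "(f has_derivative f') (at x)"
    using assms by (auto simp: differentiable_def)
  then have "linear f'"
    by (rule has_derivative_linear)
  \<comment> \<open>Riesz vector of the functional: f' h is its own product with 1, and the adjoint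
    moves f' onto that 1.\<close>
  have "f' = (\<lambda>h. inner h (adjoint f' 1))"
    using adjoint_works[OF \<open>linear f'\<close>, of _ 1] by auto
  then have "GDERIV f x :> adjoint f' 1"
    using f' by (simp add: gderiv_def)
  then show ?thesis
    by (simp add: grad_eqI)
qed

lemma has_derivative_hessian:
  assumes "twice_differentiable \<phi>"
  shows "(grad \<phi> has_derivative (\<lambda>h. hessian \<phi> x *v h)) (at x)"
  using assms by (simp add: twice_differentiable_def hessian_def flip: jacobian_works)

lemma twice_differentiable_GDERIV: "twice_differentiable \<phi> \<Longrightarrow> GDERIV \<phi> x :> grad \<phi> x"
  by (simp add: twice_differentiable_def differentiable_imp_GDERIV_grad)

section \<open>Young's theorem at a point where the gradient is differentiable\<close>

lemma GDERIV_along_line: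
  fixes f :: "'a::euclidean_space \<Rightarrow> real"
  assumes "GDERIV f (x + s *\<^sub>R h) :> D"
  shows "((\<lambda>s. f (x + s *\<^sub>R h)) has_real_derivative inner D h) (at s)"
proof -
  have "((\<lambda>s. x + s *\<^sub>R h) has_derivative (\<lambda>r. r *\<^sub>R h)) (at s)"
    by (auto intro!: derivative_eq_intros)
  moreover have "(f has_derivative (\<lambda>h. inner h D)) (at (x + s *\<^sub>R h))"
    using assms by (simp add: gderiv_def)
  ultimately have "((\<lambda>s. f (x + s *\<^sub>R h)) has_derivative (\<lambda>r. inner (r *\<^sub>R h) D)) (at s)"
    by (rule has_derivative_compose)
  then show ?thesis
    by (rule has_derivative_imp_has_field_derivative) (simp add: inner_commute)
qed

text \<open>
  The second difference is symmetric in \<open>h\<close> and \<open>k\<close>, so this forces its leading coefficient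
  \<open>inner (H h) k\<close> to be symmetric as well.
\<close>

lemma second_difference_approx:
  fixes \<phi> :: "'a::euclidean_space \<Rightarrow> real"
  assumes diff: "\<And>y. GDERIV \<phi> y :> G y"
    and H: "(G has_derivative H) (at x)" and "\<epsilon> > 0"
  shows "\<forall>\<^sub>F s in at_right 0.
    \<bar>\<phi> (x + s *\<^sub>R h + s *\<^sub>R k) - \<phi> (x + s *\<^sub>R h) - \<phi> (x + s *\<^sub>R k) + \<phi> x - s\<^sup>2 * inner (H h) k\<bar>
      \<le> \<epsilon> * s\<^sup>2 * ((norm h + 2 * norm k) * norm k)"
proof -
  interpret H: bounded_linear H
    using H by (rule has_derivative_bounded_linear)
  obtain \<delta> where "\<delta> > 0" and \<delta>: "\<And>y. norm (y - x) < \<delta> \<Longrightarrow> norm (G y - G x - H (y - x)) \<le> \<epsilon> * norm (y - x)"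
    using H \<open>\<epsilon> > 0\<close> unfolding has_derivative_at_alt by blast
  define r where "r = (\<lambda>y. G (x + y) - G x - H y)"
  have r: "norm (r y) \<le> \<epsilon> * norm y" if "norm y < \<delta>" for y
    using \<delta>[of "x + y"] that by (simp add: r_def)
  \<comment> \<open>For 0 < \<xi> < s < d both s h + \<xi> k and \<xi> k have norm below \<delta>,
    where the expansion of \<open>G\<close> is accurate; the added 1 keeps the denominator positive
    when h = k = 0.\<close>
  define d where "d = \<delta> / (norm h + norm k + 1)"
  have "d > 0"
    unfolding d_def using \<open>\<delta> > 0\<close> by (intro divide_pos_pos add_nonneg_pos) auto
  show ?thesis
    unfolding eventually_at_right_field
  proof (intro exI[of _ d] conjI allI impI)
    show "d > 0" by fact
    fix s :: real assume s: "0 < s" "s < d"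
    have "s * (norm h + norm k + 1) < \<delta>"
      using s by (simp add: d_def pos_less_divide_eq add_nonneg_pos)
    then have small: "s * norm h + s * norm k < \<delta>"
      using s by (simp add: algebra_simps)
    \<comment> \<open>\<open>w\<close> is the increment in direction h, so \<open>w s - w 0\<close>
      is the second difference; the mean value theorem in direction k turns it into a first
      difference of gradients.\<close>
    define w where "w = (\<lambda>\<tau>. \<phi> (x + s *\<^sub>R h + \<tau> *\<^sub>R k) - \<phi> (x + \<tau> *\<^sub>R k))"
    have "(w has_real_derivative inner (G (x + s *\<^sub>R h + \<tau> *\<^sub>R k)) k - inner (G (x + \<tau> *\<^sub>R k)) k) (at \<tau>)" for \<tau>
      unfolding w_def by (intro DERIV_diff GDERIV_along_line diff)
    then obtain \<xi> where \<xi>: "0 < \<xi>" "\<xi> < s"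
      and w: "w s - w 0 = s * (inner (G (x + s *\<^sub>R h + \<xi> *\<^sub>R k)) k - inner (G (x + \<xi> *\<^sub>R k)) k)"
      using MVT2[of 0 s w "\<lambda>\<tau>. inner (G (x + s *\<^sub>R h + \<tau> *\<^sub>R k)) k - inner (G (x + \<tau> *\<^sub>R k)) k"] s
      by auto
    define e where "e = r (s *\<^sub>R h + \<xi> *\<^sub>R k) - r (\<xi> *\<^sub>R k)"
    \<comment> \<open>After expanding \<open>G\<close> about x at both points, the linear parts
      differ by H (s h) alone: the unknown \<xi> drops out of them and survives only in the
      remainder \<open>e\<close>.\<close>
    have "w s - w 0 - s\<^sup>2 * inner (H h) k = s * inner e k"
      unfolding w e_def r_def
      by (simp add: H.add H.scaleR algebra_simps power2_eq_square inner_diff_left inner_add_left)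
    also have "\<bar>\<dots>\<bar> \<le> s * (norm e * norm k)"
      using s Cauchy_Schwarz_ineq2[of e k] by (simp add: abs_mult)
    also have "norm e * norm k \<le> (\<epsilon> * s * (norm h + 2 * norm k)) * norm k"
    proof (rule mult_right_mono)
      have \<xi>k: "\<xi> * norm k \<le> s * norm k"
        using \<xi> by (intro mult_right_mono) auto
      have n1: "norm (s *\<^sub>R h + \<xi> *\<^sub>R k) \<le> s * norm h + s * norm k"
        using norm_triangle_ineq[of "s *\<^sub>R h" "\<xi> *\<^sub>R k"] \<xi>k s \<xi> by simp
      have n2: "norm (\<xi> *\<^sub>R k) \<le> s * norm k"
        using \<xi>k \<xi> by simp
      have "0 \<le> s * norm h" using s by simp
      have "norm e \<le> norm (r (s *\<^sub>R h + \<xi> *\<^sub>R k)) + norm (r (\<xi> *\<^sub>R k))"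
        unfolding e_def by (rule norm_triangle_ineq4)
      also have "\<dots> \<le> \<epsilon> * norm (s *\<^sub>R h + \<xi> *\<^sub>R k) + \<epsilon> * norm (\<xi> *\<^sub>R k)"
        using n1 n2 small \<open>0 \<le> s * norm h\<close> by (intro add_mono r) auto
      also have "\<dots> \<le> \<epsilon> * (s * norm h + s * norm k) + \<epsilon> * (s * norm k)"
        using n1 n2 \<open>\<epsilon> > 0\<close> by (intro add_mono mult_left_mono) auto
      finally show "norm e \<le> \<epsilon> * s * (norm h + 2 * norm k)"
        by (simp add: algebra_simps)
    qed simp
    finally have "\<bar>w s - w 0 - s\<^sup>2 * inner (H h) k\<bar> \<le> s * (\<epsilon> * s * (norm h + 2 * norm k) * norm k)"
      using s by simp
    then show "\<bar>\<phi> (x + s *\<^sub>R h + s *\<^sub>R k) - \<phi> (x + s *\<^sub>R h) - \<phi> (x + s *\<^sub>R k) + \<phi> x - s\<^sup>2 * inner (H h) k\<bar>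
        \<le> \<epsilon> * s\<^sup>2 * ((norm h + 2 * norm k) * norm k)"
      by (simp add: w_def algebra_simps power2_eq_square)
  qed
qed

text \<open>One and the same second difference is approximated by s^2 <H h, k> and by s^2 <H k, h>,
  each with an error of order \<epsilon> s^2. Dividing by s^2 bounds the asymmetry by \<epsilon> K,
  and \<epsilon> tends to 0.\<close>

lemma gradient_derivative_symmetric:
  fixes \<phi> :: "'a::euclidean_space \<Rightarrow> real"
  assumes diff: "\<And>y. GDERIV \<phi> y :> G y" and H: "(G has_derivative H) (at x)"
  shows "inner (H h) k = inner h (H k)"
proof -
  define K where "K = (norm h + 2 * norm k) * norm k + (norm k + 2 * norm h) * norm h"
  have "\<bar>inner (H h) k - inner h (H k)\<bar> \<le> \<epsilon> * K" if "\<epsilon> > 0" for \<epsilon>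
  proof -
    have "\<forall>\<^sub>F s::real in at_right 0. \<bar>inner (H h) k - inner h (H k)\<bar> \<le> \<epsilon> * K"
      using second_difference_approx[OF diff H that, of h k]
        second_difference_approx[OF diff H that, of k h] eventually_at_right_less[of 0]
    proof eventually_elim
      case (elim s)
      have comm: "x + s *\<^sub>R k + s *\<^sub>R h = x + s *\<^sub>R h + s *\<^sub>R k"
        by simp
      have "\<bar>s\<^sup>2 * inner (H h) k - s\<^sup>2 * inner (H k) h\<bar>
          \<le> \<epsilon> * s\<^sup>2 * ((norm h + 2 * norm k) * norm k) + \<epsilon> * s\<^sup>2 * ((norm k + 2 * norm h) * norm h)"
        using elim(1,2) unfolding comm by linarith
      also have "\<dots> = s\<^sup>2 * (\<epsilon> * K)"
        by (simp add: K_def algebra_simps)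
      also have "s\<^sup>2 * inner (H h) k - s\<^sup>2 * inner (H k) h = s\<^sup>2 * (inner (H h) k - inner h (H k))"
        by (simp add: algebra_simps inner_commute)
      finally have "s\<^sup>2 * \<bar>inner (H h) k - inner h (H k)\<bar> \<le> s\<^sup>2 * (\<epsilon> * K)"
        by (simp add: abs_mult)
      then show ?case
        using elim(3) by simp
    qed
    \<comment> \<open>The inequality no longer mentions s, and \<open>at_right 0\<close> is a
      nontrivial filter.\<close>
    then show ?thesis
      by (simp add: eventually_const)
  qed
  then have "\<forall>\<^sub>F \<epsilon> in at_right 0. \<bar>inner (H h) k - inner h (H k)\<bar> \<le> \<epsilon> * K"
    by (auto intro: eventually_mono[OF eventually_at_right_less])
  moreover have "((\<lambda>\<epsilon>. \<epsilon> * K) \<longlongrightarrow> 0 * K) (at_right 0)"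
    by (intro tendsto_intros)
  ultimately have "\<bar>inner (H h) k - inner h (H k)\<bar> \<le> 0 * K"
    by (intro tendsto_lowerbound) auto
  then show ?thesis
    by simp
qed

lemma hessian_symmetric:
  assumes "twice_differentiable \<phi>"
  shows "inner (hessian \<phi> x *v h) k = inner h (hessian \<phi> x *v k)"
  by (rule gradient_derivative_symmetric[OF twice_differentiable_GDERIV has_derivative_hessian])
    (rule assms)+

section \<open>Strong convexity and invertibility of the Hessian\<close>

text \<open>In the convexity inequality at (1 - \<theta>) x + \<theta> y, subtract the value at x,
  divide by \<theta> and let \<theta> decrease to 0: the difference quotient becomes the directional
  derivative and the factor 1 - \<theta> becomes 1.\<close>

lemma strongly_convex_grad_lower_bound:
  fixes \<phi> :: "'a::euclidean_space \<Rightarrow> real"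
  assumes "strongly_convex \<phi>" and diff: "\<And>x. GDERIV \<phi> x :> G x"
  obtains \<sigma> where "\<sigma> > 0"
    "\<And>x y. \<phi> x + inner (G x) (y - x) + \<sigma> / 2 * (norm (y - x))\<^sup>2 \<le> \<phi> y"
proof -
  obtain \<sigma> where "\<sigma> > 0" and \<sigma>: "\<And>x y \<theta>. \<theta> \<in> {0..1} \<Longrightarrow> \<phi> ((1 - \<theta>) *\<^sub>R x + \<theta> *\<^sub>R y)
       \<le> (1 - \<theta>) * \<phi> x + \<theta> * \<phi> y - \<sigma> / 2 * \<theta> * (1 - \<theta>) * (norm (x - y))\<^sup>2"
    using assms(1) unfolding strongly_convex_def by blast
  have "\<phi> x + inner (G x) (y - x) + \<sigma> / 2 * (norm (y - x))\<^sup>2 \<le> \<phi> y" for x y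
  proof -
    have "((\<lambda>\<theta>. \<phi> (x + \<theta> *\<^sub>R (y - x))) has_real_derivative inner (G x) (y - x)) (at 0)"
      by (rule GDERIV_along_line) (simp add: diff)
    then have "((\<lambda>\<theta>. (\<phi> (x + \<theta> *\<^sub>R (y - x)) - \<phi> x) / \<theta>) \<longlongrightarrow> inner (G x) (y - x)) (at_right 0)"
      unfolding DERIV_def by (simp add: filterlim_at_split)
    moreover have "((\<lambda>\<theta>. \<phi> y - \<phi> x - \<sigma> / 2 * (1 - \<theta>) * (norm (x - y))\<^sup>2)
        \<longlongrightarrow> \<phi> y - \<phi> x - \<sigma> / 2 * (1 - 0) * (norm (x - y))\<^sup>2) (at_right 0)"
      by (intro tendsto_intros)
    moreover have "\<forall>\<^sub>F \<theta> in at_right 0. (\<phi> (x + \<theta> *\<^sub>R (y - x)) - \<phi> x) / \<theta>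
        \<le> \<phi> y - \<phi> x - \<sigma> / 2 * (1 - \<theta>) * (norm (x - y))\<^sup>2"
      unfolding eventually_at_right_field
    proof (intro exI[of _ 1] conjI allI impI)
      fix \<theta> :: real assume \<theta>: "0 < \<theta>" "\<theta> < 1"
      have "x + \<theta> *\<^sub>R (y - x) = (1 - \<theta>) *\<^sub>R x + \<theta> *\<^sub>R y"
        by (simp add: algebra_simps)
      then have "\<phi> (x + \<theta> *\<^sub>R (y - x)) - \<phi> x
          \<le> (\<phi> y - \<phi> x - \<sigma> / 2 * (1 - \<theta>) * (norm (x - y))\<^sup>2) * \<theta>"
        using \<sigma>[of \<theta> x y] \<theta> by (simp add: algebra_simps)
      then show "(\<phi> (x + \<theta> *\<^sub>R (y - x)) - \<phi> x) / \<theta>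
          \<le> \<phi> y - \<phi> x - \<sigma> / 2 * (1 - \<theta>) * (norm (x - y))\<^sup>2"
        using \<theta> by (simp add: pos_divide_le_eq)
    qed simp
    ultimately have "inner (G x) (y - x) \<le> \<phi> y - \<phi> x - \<sigma> / 2 * (1 - 0) * (norm (x - y))\<^sup>2"
      by (intro tendsto_le[OF _ _ _]) auto
    then show ?thesis
      by (simp add: norm_minus_commute)
  qed
  then show ?thesis
    using that \<open>\<sigma> > 0\<close> by blast
qed

text \<open>Strong monotonicity of the gradient bounds the difference quotient of <grad, h> along h
  from below by \<sigma> |h|^2, and this quotient tends to the quadratic form of the
  Hessian.\<close>

lemma strongly_convex_hessian_coercive:
  assumes "strongly_convex \<phi>" "twice_differentiable \<phi>"
  obtains \<sigma> where "\<sigma> > 0" "\<And>x h. \<sigma> * (norm h)\<^sup>2 \<le> inner (hessian \<phi> x *v h) h"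
proof -
  obtain \<sigma> where "\<sigma> > 0"
    and \<sigma>: "\<And>x y. \<phi> x + inner (grad \<phi> x) (y - x) + \<sigma> / 2 * (norm (y - x))\<^sup>2 \<le> \<phi> y"
    using strongly_convex_grad_lower_bound[OF assms(1) twice_differentiable_GDERIV[OF assms(2)]]
    by blast
  have "\<sigma> * (norm h)\<^sup>2 \<le> inner (hessian \<phi> x *v h) h" for x h
  proof -
    have "((\<lambda>s. inner (grad \<phi> (x + s *\<^sub>R h)) h) has_real_derivative inner (hessian \<phi> x *v h) h) (at 0)"
    proof -
      have "((\<lambda>s. x + s *\<^sub>R h) has_derivative (\<lambda>r. r *\<^sub>R h)) (at 0)"
        by (auto intro!: derivative_eq_intros)
      moreover have "(grad \<phi> has_derivative (\<lambda>h. hessian \<phi> x *v h)) (at (x + 0 *\<^sub>R h))"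
        using has_derivative_hessian[OF assms(2)] by simp
      ultimately have "((\<lambda>s. grad \<phi> (x + s *\<^sub>R h)) has_derivative (\<lambda>r. hessian \<phi> x *v (r *\<^sub>R h))) (at 0)"
        by (rule has_derivative_compose)
      then have "((\<lambda>s. inner (grad \<phi> (x + s *\<^sub>R h)) h) has_derivative (\<lambda>r. inner (hessian \<phi> x *v (r *\<^sub>R h)) h)) (at 0)"
        by (rule has_derivative_inner_left)
      then show ?thesis
        by (rule has_derivative_imp_has_field_derivative)
          (simp add: matrix_vector_mult_scaleR)
    qed
    then have "((\<lambda>s. (inner (grad \<phi> (x + s *\<^sub>R h)) h - inner (grad \<phi> x) h) / s)
        \<longlongrightarrow> inner (hessian \<phi> x *v h) h) (at_right 0)"
      unfolding DERIV_def by (simp add: filterlim_at_split)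
    moreover have "\<forall>\<^sub>F s in at_right 0.
        \<sigma> * (norm h)\<^sup>2 \<le> (inner (grad \<phi> (x + s *\<^sub>R h)) h - inner (grad \<phi> x) h) / s"
      using eventually_at_right_less[of 0]
    proof eventually_elim
      case (elim s)
      \<comment> \<open>Sum of the lower bounds from x to x + s h and back: the function values
        cancel and the two halves of \<sigma> add up.\<close>
      have "s * (\<sigma> * (norm h)\<^sup>2 * s) \<le> s * (inner (grad \<phi> (x + s *\<^sub>R h)) h - inner (grad \<phi> x) h)"
        using \<sigma>[of x "x + s *\<^sub>R h"] \<sigma>[of "x + s *\<^sub>R h" x]
        by (simp add: algebra_simps power_mult_distrib power2_eq_square)
      then have "\<sigma> * (norm h)\<^sup>2 * s \<le> inner (grad \<phi> (x + s *\<^sub>R h)) h - inner (grad \<phi> x) h"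
        using elim by simp
      then show ?case
        using elim by (simp add: pos_le_divide_eq)
    qed
    ultimately show ?thesis
      by (intro tendsto_lowerbound) auto
  qed
  then show ?thesis
    using that \<open>\<sigma> > 0\<close> by blast
qed

text \<open>Coercivity forces a trivial kernel, which for a square matrix amounts to
  invertibility.\<close>

lemma strongly_convex_invertible_hessian:
  assumes "strongly_convex \<phi>" "twice_differentiable \<phi>"
  shows "invertible (hessian \<phi> x)"
proof -
  obtain \<sigma> where "\<sigma> > 0" and \<sigma>: "\<And>x h. \<sigma> * (norm h)\<^sup>2 \<le> inner (hessian \<phi> x *v h) h"
    using strongly_convex_hessian_coercive[OF assms] by blast
  have "h = 0" if "hessian \<phi> x *v h = 0" for h
    using \<sigma>[of h x] that \<open>\<sigma> > 0\<close> by (simp add: mult_le_0_iff)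
  then show ?thesis
    by (metis invertible_left_inverse matrix_left_invertible_ker)
qed

lemma matrix_vector_eq_iff_matrix_inv:
  fixes M :: "real^'n^'n"
  assumes "invertible M"
  shows "M *v y = w \<longleftrightarrow> y = matrix_inv M *v w"
proof -
  have "M ** matrix_inv M = mat 1 \<and> matrix_inv M ** M = mat 1"
    using assms unfolding invertible_def matrix_inv_def by (rule someI_ex)
  then show ?thesis
    by (metis matrix_vector_mul_assoc matrix_vector_mul_lid)
qed

section \<open>The gradient of the Fenchel conjugate\<close>

text \<open>At G z + h the conjugate is squeezed between the affine function c + <h, z> and the same
  function plus |h|^2 / (2 \<sigma>). The gap is quadratic in h, so z is the gradient at G
  z.\<close>

lemma grad_fenchel_conj_grad:
  fixes \<phi> :: "'a::euclidean_space \<Rightarrow> real"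
  assumes "strongly_convex \<phi>" and diff: "\<And>x. GDERIV \<phi> x :> G x"
  shows "grad (fenchel_conj \<phi>) (G z) = z"
proof -
  obtain \<sigma> where "\<sigma> > 0" and \<sigma>: "\<And>x y. \<phi> x + inner (G x) (y - x) + \<sigma> / 2 * (norm (y - x))\<^sup>2 \<le> \<phi> y"
    using strongly_convex_grad_lower_bound[OF assms] by blast
  define c where "c = inner (G z) z - \<phi> z"
  have upper: "inner (G z + h) y - \<phi> y \<le> c + inner h z + (norm h)\<^sup>2 / (2 * \<sigma>)" for h y
  proof -
    \<comment> \<open>Completing the square gives Young's inequality <h, y - z> \<le> |h|^2 / (2
      \<sigma>) + (\<sigma> / 2) |y - z|^2, whose last term is absorbed by the strong convexity
      bound.\<close>
    have "0 \<le> (norm (h - \<sigma> *\<^sub>R (y - z)))\<^sup>2 / (2 * \<sigma>)"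
      using \<open>\<sigma> > 0\<close> by simp
    also have "(norm (h - \<sigma> *\<^sub>R (y - z)))\<^sup>2 =
        (norm h)\<^sup>2 - 2 * \<sigma> * inner h (y - z) + \<sigma>\<^sup>2 * (norm (y - z))\<^sup>2"
      using dot_norm_neg[of h "\<sigma> *\<^sub>R (y - z)"] by (simp add: power_mult_distrib)
    also have "\<dots> / (2 * \<sigma>) = (norm h)\<^sup>2 / (2 * \<sigma>) - inner h (y - z) + \<sigma> / 2 * (norm (y - z))\<^sup>2"
      using \<open>\<sigma> > 0\<close> by (simp add: field_simps power2_eq_square)
    finally show ?thesis
      using \<sigma>[of z y] by (simp add: c_def inner_add_left inner_diff_right)
  qed
  have conj_upper: "fenchel_conj \<phi> (G z + h) \<le> c + inner h z + (norm h)\<^sup>2 / (2 * \<sigma>)" for h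
    unfolding fenchel_conj_def by (rule cSUP_least) (auto intro: upper)
  have conj_lower: "c + inner h z \<le> fenchel_conj \<phi> (G z + h)" for h
  proof -
    \<comment> \<open>The competitor y = z gives the lower bound; \<open>upper\<close> supplies the
      finiteness without which a real-valued supremum carries no information.\<close>
    have "inner (G z + h) z - \<phi> z \<le> fenchel_conj \<phi> (G z + h)"
      unfolding fenchel_conj_def
      by (rule cSUP_upper) (auto intro!: bdd_aboveI2 upper)
    then show ?thesis
      by (simp add: c_def inner_add_left)
  qed
  have conj: "fenchel_conj \<phi> (G z) = c"
    using conj_upper[of 0] conj_lower[of 0] by simp
  have "GDERIV (fenchel_conj \<phi>) (G z) :> z"
    unfolding gderiv_def has_derivative_at_alt
  proof (intro conjI allI impI bounded_linear_inner_left)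
    fix e :: real assume "e > 0"
    show "\<exists>d>0. \<forall>y. norm (y - G z) < d \<longrightarrow>
        norm (fenchel_conj \<phi> y - fenchel_conj \<phi> (G z) - inner (y - G z) z) \<le> e * norm (y - G z)"
    \<comment> \<open>The radius is chosen so that |h| < 2 \<sigma> e makes the gap |h|^2 / (2
      \<sigma>) at most e |h|.\<close>
    proof (intro exI[of _ "2 * \<sigma> * e"] conjI allI impI)
      fix y assume y: "norm (y - G z) < 2 * \<sigma> * e"
      have "\<bar>fenchel_conj \<phi> y - c - inner (y - G z) z\<bar> \<le> (norm (y - G z))\<^sup>2 / (2 * \<sigma>)"
        using conj_upper[of "y - G z"] conj_lower[of "y - G z"] by simp
      also have "\<dots> = norm (y - G z) / (2 * \<sigma>) * norm (y - G z)"
        by (simp add: power2_eq_square)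
      also have "\<dots> \<le> e * norm (y - G z)"
        using y \<open>\<sigma> > 0\<close> by (intro mult_right_mono) (auto simp: field_simps)
      finally show "norm (fenchel_conj \<phi> y - fenchel_conj \<phi> (G z) - inner (y - G z) z) \<le> e * norm (y - G z)"
        by (simp add: conj)
    qed (use \<open>\<sigma> > 0\<close> \<open>e > 0\<close> in simp)
  qed
  then show ?thesis
    by (rule grad_eqI)
qed

section \<open>Partial gradients of the Bregman divergence and the augmented Lagrangian\<close>

lemma GDERIV_shift_scale:
  fixes f :: "'a::euclidean_space \<Rightarrow> real"
  assumes "GDERIV f (x + c *\<^sub>R v) :> D"
  shows "GDERIV (\<lambda>v. f (x + c *\<^sub>R v)) v :> c *\<^sub>R D" "GDERIV (\<lambda>x. f (x + c *\<^sub>R v)) x :> D"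
proof -
  have f: "(f has_derivative (\<lambda>h. inner h D)) (at (x + c *\<^sub>R v))"
    using assms by (simp add: gderiv_def)
  have "((\<lambda>v. x + c *\<^sub>R v) has_derivative (\<lambda>h. c *\<^sub>R h)) (at v)"
    by (auto intro!: derivative_eq_intros)
  from has_derivative_compose[OF this f] show "GDERIV (\<lambda>v. f (x + c *\<^sub>R v)) v :> c *\<^sub>R D"
    by (simp add: gderiv_def)
  have "((\<lambda>x. x + c *\<^sub>R v) has_derivative (\<lambda>h. h)) (at x)"
    by (auto intro!: derivative_eq_intros)
  from has_derivative_compose[OF this f] show "GDERIV (\<lambda>x. f (x + c *\<^sub>R v)) x :> D"
    by (simp add: gderiv_def)
qed

lemma GDERIV_bregman_div_velocity:
  fixes \<phi> :: "'a::euclidean_space \<Rightarrow> real"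
  assumes "\<And>x. GDERIV \<phi> x :> grad \<phi> x"
  shows "GDERIV (\<lambda>v. bregman_div \<phi> (x + c *\<^sub>R v) x) v :> c *\<^sub>R (grad \<phi> (x + c *\<^sub>R v) - grad \<phi> x)"
proof -
  have "GDERIV (\<lambda>v. inner (grad \<phi> x) (c *\<^sub>R v)) v :> c *\<^sub>R grad \<phi> x"
    unfolding gderiv_def by (auto intro!: derivative_eq_intros simp: inner_commute)
  with GDERIV_shift_scale(1)[OF assms] show ?thesis
    unfolding bregman_div_def
    by (auto intro!: GDERIV_subst[OF GDERIV_diff[OF GDERIV_diff[OF _ GDERIV_const]]]
        simp: scaleR_diff_right)
qed

text \<open>The symmetry of the Hessian moves it from the increment to the velocity.\<close>

lemma GDERIV_bregman_div_position:
  assumes "twice_differentiable \<phi>"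
  shows "GDERIV (\<lambda>x. bregman_div \<phi> (x + c *\<^sub>R v) x) x
    :> grad \<phi> (x + c *\<^sub>R v) - grad \<phi> x - c *\<^sub>R (hessian \<phi> x *v v)"
proof -
  have "((\<lambda>x. inner (grad \<phi> x) (c *\<^sub>R v)) has_derivative (\<lambda>h. inner (hessian \<phi> x *v h) (c *\<^sub>R v))) (at x)"
    by (rule has_derivative_inner_left[OF has_derivative_hessian[OF assms]])
  then have "GDERIV (\<lambda>x. inner (grad \<phi> x) (c *\<^sub>R v)) x :> c *\<^sub>R (hessian \<phi> x *v v)"
    by (simp add: gderiv_def hessian_symmetric[OF assms])
  then have "GDERIV (\<lambda>x. \<phi> (x + c *\<^sub>R v) - \<phi> x - inner (grad \<phi> x) (c *\<^sub>R v)) x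
      :> grad \<phi> (x + c *\<^sub>R v) - grad \<phi> x - c *\<^sub>R (hessian \<phi> x *v v)"
    by (intro GDERIV_diff GDERIV_shift_scale(2) twice_differentiable_GDERIV[OF assms])
  then show ?thesis
    by (simp add: bregman_div_def)
qed

lemma GDERIV_cmult:
  fixes f :: "'a::real_inner \<Rightarrow> real"
  shows "GDERIV f x :> D \<Longrightarrow> GDERIV (\<lambda>x. k * f x) x :> k *\<^sub>R D"
  using GDERIV_mult[OF GDERIV_const] by fastforce

text \<open>All summands except the one with index i are constant in y, since \<open>V\<close>
  freezes the other blocks; block gradients of separable sums thus reduce to a single
  summand.\<close>

lemma GDERIV_block_sum:
  fixes P :: "'k::finite \<Rightarrow> 'a::euclidean_space \<Rightarrow> real"
  assumes "GDERIV (P i) y :> D"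
  shows "GDERIV (\<lambda>y. \<Sum>j\<in>UNIV. P j (if j = i then y else V j)) y :> D"
proof -
  have "(\<Sum>j\<in>UNIV. P j (if j = i then y else V j)) = P i y + (\<Sum>j\<in>UNIV - {i}. P j (V j))" for y
    by (subst sum.remove[of _ i]) (auto intro!: sum.cong)
  then show ?thesis
    using GDERIV_add[OF assms GDERIV_const] by simp
qed

text \<open>Prepares the splitting of the Bregman divergence over blocks, as that divergence is
  defined through the full gradient.\<close>

lemma grad_separable_sum:
  fixes \<phi> :: "'k::finite \<Rightarrow> real^'n \<Rightarrow> real"
  assumes "\<And>i x. GDERIV (\<phi> i) x :> grad (\<phi> i) x"
  shows "grad (separable_sum \<phi>) x = (\<chi> i. grad (\<phi> i) (x $ i))"
proof (rule grad_eqI)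
  have "((\<lambda>x. \<phi> i (x $ i)) has_derivative (\<lambda>h. inner (h $ i) (grad (\<phi> i) (x $ i)))) (at x)" for i
    using has_derivative_compose[OF bounded_linear_imp_has_derivative[OF bounded_linear_vec_nth]
        assms[unfolded gderiv_def]] .
  then have "((\<lambda>x. \<Sum>i\<in>UNIV. \<phi> i (x $ i)) has_derivative
      (\<lambda>h. \<Sum>i\<in>UNIV. inner (h $ i) (grad (\<phi> i) (x $ i)))) (at x)"
    by (intro has_derivative_sum)
  then show "GDERIV (separable_sum \<phi>) x :> (\<chi> i. grad (\<phi> i) (x $ i))"
    by (simp add: gderiv_def separable_sum_def[abs_def] inner_vec_def)
qed

lemma bregman_div_separable_sum:
  fixes \<phi> :: "'k::finite \<Rightarrow> real^'n \<Rightarrow> real"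
  assumes "\<And>i x. GDERIV (\<phi> i) x :> grad (\<phi> i) x"
  shows "bregman_div (separable_sum \<phi>) y x = (\<Sum>i\<in>UNIV. bregman_div (\<phi> i) (y $ i) (x $ i))"
  by (simp add: bregman_div_def grad_separable_sum[OF assms] separable_sum_def inner_vec_def
      sum_subtractf)

text \<open>The equations keep the gradient of the augmented Lagrangian unevaluated;
  differentiability is what makes the description \<open>grad\<close> denote it.\<close>

lemma differentiable_aug_lagrangian_block:
  assumes "\<And>j. f j differentiable (at (if j = i then y else V $ j))"
  shows "(\<lambda>y. aug_lagrangian f A C \<mu> (\<chi> j. if j = i then y else V $ j) l) differentiable (at y)"
proof -
  have "(\<lambda>y. f j (if j = i then y else V $ j)) differentiable (at y)" for j
    using assms[of j] by (cases "j = i") auto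
  moreover have "(\<lambda>y. A j *v (if j = i then y else V $ j)) differentiable (at y)" for j
    by (cases "j = i") (auto intro: linear_imp_differentiable)
  ultimately show ?thesis
    unfolding aug_lagrangian_def separable_sum_def residual_def power2_norm_eq_inner
    by (auto intro!: differentiable_add differentiable_mult differentiable_inner
        differentiable_diff differentiable_sum)
qed

lemma differentiable_aug_lagrangian_multiplier:
  "(\<lambda>l. aug_lagrangian f A C \<mu> x l) differentiable (at l)"
  unfolding aug_lagrangian_def
  by (auto intro!: differentiable_add differentiable_inner)

section \<open>The Euler--Lagrange equation of a single block\<close>

text \<open>One computation serves primal blocks and multiplier alike: \<open>p\<close> is the
  momentum, the term subtracted from its derivative is the position gradient, and the free vector
  \<open>W\<close> is e^b times the gradient of the augmented Lagrangian, with sign plus for a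
  primal block and minus for the multiplier.\<close>

lemma bregman_momentum_equation:
  fixes \<phi> :: "real^'n \<Rightarrow> real" and q v :: "real \<Rightarrow> real^'n" and a g :: "real \<Rightarrow> real"
  assumes "strongly_convex \<phi>" and td: "twice_differentiable \<phi>"
    and nontriv: "at t within T \<noteq> bot"
    and q: "(q has_vector_derivative v t) (at t within T)"
    and v: "(v has_vector_derivative w) (at t within T)"
    and a: "(a has_vector_derivative a') (at t within T)"
    and g: "(g has_vector_derivative exp (a t)) (at t within T)"
  defines "z \<equiv> \<lambda>s. q s + exp (- a s) *\<^sub>R v s"
  defines "p \<equiv> \<lambda>s. exp (g s) *\<^sub>R (grad \<phi> (z s) - grad \<phi> (q s))"
  shows
    "p differentiable (at t within T) \<and>
      tderiv T p t - exp (a t + g t) *\<^sub>R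
        (grad \<phi> (z t) - grad \<phi> (q t) - exp (- a t) *\<^sub>R (hessian \<phi> (q t) *v v t) - W) = 0
      \<longleftrightarrow> w + (exp (a t) - a') *\<^sub>R v t + exp (2 * a t) *\<^sub>R (matrix_inv (hessian \<phi> (z t)) *v W) = 0"
      (is "?EL \<longleftrightarrow> ?ODE")
    and "w + (exp (a t) - a') *\<^sub>R v t + exp (2 * a t) *\<^sub>R (matrix_inv (hessian \<phi> (z t)) *v W) = 0 \<Longrightarrow>
      ((\<lambda>s. grad \<phi> (z s)) has_vector_derivative - exp (a t) *\<^sub>R W) (at t within T)"
proof -
  define M where "M = hessian \<phi> (z t)"
  define z' where "z' = v t + exp (- a t) *\<^sub>R w - (a' * exp (- a t)) *\<^sub>R v t"
  have exp_cancel: "exp (a t) * exp (- a t) = 1"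
    by (simp flip: exp_add)
  have z: "(z has_vector_derivative z') (at t within T)"
    unfolding z_def z'_def
    by (rule derivative_eq_intros q v a refl | simp add: has_real_derivative_iff_has_vector_derivative a)+
  have grad_along: "((\<lambda>s. grad \<phi> (y s)) has_vector_derivative hessian \<phi> (y t) *v y') (at t within T)"
    if "(y has_vector_derivative y') (at t within T)" for y y'
    using has_derivative_compose[OF that[unfolded has_vector_derivative_def] has_derivative_hessian[OF td]]
    by (simp add: has_vector_derivative_def matrix_vector_mult_scaleR)
  have "(p has_vector_derivative
      (exp (g t) *\<^sub>R (M *v z' - hessian \<phi> (q t) *v v t)
        + (exp (g t) * exp (a t)) *\<^sub>R (grad \<phi> (z t) - grad \<phi> (q t)))) (at t within T)"
    unfolding p_def M_def
    by (rule derivative_eq_intros grad_along z q g refl | simp add: has_real_derivative_iff_has_vector_derivative g)+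
  then have "p differentiable (at t within T)"
    and "tderiv T p t = exp (g t) *\<^sub>R (M *v z' - hessian \<phi> (q t) *v v t)
        + (exp (g t) * exp (a t)) *\<^sub>R (grad \<phi> (z t) - grad \<phi> (q t))"
    using nontriv by (auto simp: tderiv_def vector_derivative_within differentiableI_vector)
  \<comment> \<open>Two cancellations: g' = e^a makes the gradient differences agree, and e^(a+g)
    e^(-a) = e^g removes the Hessian at q. The remaining factor e^g never vanishes.\<close>
  moreover have "exp (g t) *\<^sub>R (M *v z' - hessian \<phi> (q t) *v v t)
        + (exp (g t) * exp (a t)) *\<^sub>R (grad \<phi> (z t) - grad \<phi> (q t))
      - exp (a t + g t) *\<^sub>R
        (grad \<phi> (z t) - grad \<phi> (q t) - exp (- a t) *\<^sub>R (hessian \<phi> (q t) *v v t) - W)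
      = exp (g t) *\<^sub>R (M *v z' + exp (a t) *\<^sub>R W)"
    using exp_cancel by (simp add: exp_add algebra_simps)
  ultimately have EL: "?EL \<longleftrightarrow> M *v z' + exp (a t) *\<^sub>R W = 0"
    by simp
  have "M *v z' + exp (a t) *\<^sub>R W = 0 \<longleftrightarrow> M *v z' = - (exp (a t) *\<^sub>R W)"
    by (simp add: eq_neg_iff_add_eq_0)
  also have "\<dots> \<longleftrightarrow> z' = matrix_inv M *v (- (exp (a t) *\<^sub>R W))"
    unfolding M_def
    by (rule matrix_vector_eq_iff_matrix_inv strongly_convex_invertible_hessian assms)+
  also have "\<dots> \<longleftrightarrow> exp (a t) *\<^sub>R (z' + exp (a t) *\<^sub>R (matrix_inv M *v W)) = 0"
    by (simp add: eq_neg_iff_add_eq_0 matrix_vector_mult_scaleR vec.neg)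
  \<comment> \<open>Multiplying by e^a clears the e^(-a) in z' and leaves the acceleration with
    coefficient 1: e^a z' = w + (e^a - a') v.\<close>
  also have "exp (a t) *\<^sub>R (z' + exp (a t) *\<^sub>R (matrix_inv M *v W))
      = w + (exp (a t) - a') *\<^sub>R v t + exp (2 * a t) *\<^sub>R (matrix_inv M *v W)"
    using exp_cancel unfolding mult_2 exp_add by (simp add: z'_def algebra_simps)
  finally have ODE: "?ODE \<longleftrightarrow> M *v z' + exp (a t) *\<^sub>R W = 0"
    by (simp add: M_def)
  show "?EL \<longleftrightarrow> ?ODE"
    using EL ODE by blast
  \<comment> \<open>M z' is the derivative of the gradient along z by the chain rule, so the
    equivalence read backwards gives the dual flow.\<close>
  assume ?ODE
  then have "M *v z' = - exp (a t) *\<^sub>R W"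
    using ODE by (simp add: eq_neg_iff_add_eq_0)
  then show "((\<lambda>s. grad \<phi> (z s)) has_vector_derivative - exp (a t) *\<^sub>R W) (at t within T)"
    using grad_along[OF z] by (simp add: M_def)
qed

section \<open>Momenta and position gradients of the two Bregman Lagrangians\<close>

text \<open>The augmented Lagrangian is constant in the velocity, and the prefactor e^(a+g) meets
  the e^(-a) of the chain rule, leaving e^g.\<close>

lemma block_grad_bregman_velocity:
  assumes "\<And>i x. GDERIV (\<phi> i) x :> grad (\<phi> i) x"
  shows "block_grad i (\<lambda>v. bregman_lagrangian_x (separable_sum \<phi>) \<L> a b g zl x v s) v
    = exp (g s) *\<^sub>R (grad (\<phi> i) (x $ i + exp (- a s) *\<^sub>R v $ i) - grad (\<phi> i) (x $ i))"
proof -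
  define c where "c = exp (- a s)"
  have "exp (a s + g s) * c = exp (g s)"
    by (simp add: c_def flip: exp_add)
  moreover have "GDERIV (\<lambda>y. \<Sum>j\<in>UNIV. bregman_div (\<phi> j) (x $ j + c *\<^sub>R (if j = i then y else v $ j)) (x $ j)) (v $ i)
      :> c *\<^sub>R (grad (\<phi> i) (x $ i + c *\<^sub>R v $ i) - grad (\<phi> i) (x $ i))"
    by (rule GDERIV_block_sum[where P = "\<lambda>j y. bregman_div (\<phi> j) (x $ j + c *\<^sub>R y) (x $ j)"])
      (rule GDERIV_bregman_div_velocity[OF assms])
  then have "GDERIV (\<lambda>y. exp (a s + g s) * ((\<Sum>j\<in>UNIV.
        bregman_div (\<phi> j) (x $ j + c *\<^sub>R (if j = i then y else v $ j)) (x $ j)) - exp (b s) * \<L> x (zl s))) (v $ i)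
      :> exp (a s + g s) *\<^sub>R (c *\<^sub>R (grad (\<phi> i) (x $ i + c *\<^sub>R v $ i) - grad (\<phi> i) (x $ i)) - 0)"
    by (intro GDERIV_cmult GDERIV_diff GDERIV_const)
  ultimately show ?thesis
    unfolding block_grad_def bregman_lagrangian_x_def
    by (intro grad_eqI) (simp add: bregman_div_separable_sum[OF assms] flip: c_def)
qed

lemma block_grad_bregman_position:
  fixes \<L> :: "(real^'n)^'k::finite \<Rightarrow> 'b \<Rightarrow> real"
  assumes td: "\<And>i. twice_differentiable (\<phi> i)"
    and \<L>: "(\<lambda>y. \<L> (\<chi> j. if j = i then y else x $ j) (zl s)) differentiable (at (x $ i))"
  shows "block_grad i (\<lambda>x. bregman_lagrangian_x (separable_sum \<phi>) \<L> a b g zl x v s) x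
    = exp (a s + g s) *\<^sub>R
        (grad (\<phi> i) (x $ i + exp (- a s) *\<^sub>R v $ i) - grad (\<phi> i) (x $ i)
          - exp (- a s) *\<^sub>R (hessian (\<phi> i) (x $ i) *v v $ i)
          - exp (b s) *\<^sub>R block_grad i (\<lambda>x. \<L> x (zl s)) x)"
proof -
  define c where "c = exp (- a s)"
  \<comment> \<open>Abbreviated so that this inner block gradient stays intact while the outer
    \<open>block_grad\<close> is unfolded.\<close>
  define D where "D = block_grad i (\<lambda>x. \<L> x (zl s)) x"
  have "GDERIV (\<lambda>y. \<Sum>j\<in>UNIV.
      bregman_div (\<phi> j) ((if j = i then y else x $ j) + c *\<^sub>R v $ j) (if j = i then y else x $ j)) (x $ i)
      :> grad (\<phi> i) (x $ i + c *\<^sub>R v $ i) - grad (\<phi> i) (x $ i) - c *\<^sub>R (hessian (\<phi> i) (x $ i) *v v $ i)"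
    by (rule GDERIV_block_sum[where P = "\<lambda>j y. bregman_div (\<phi> j) (y + c *\<^sub>R v $ j) y"])
      (rule GDERIV_bregman_div_position[OF td])
  moreover have "GDERIV (\<lambda>y. \<L> (\<chi> j. if j = i then y else x $ j) (zl s)) (x $ i)
      :> D"
    unfolding D_def block_grad_def by (rule differentiable_imp_GDERIV_grad[OF \<L>])
  ultimately have "GDERIV (\<lambda>y. exp (a s + g s) * ((\<Sum>j\<in>UNIV.
      bregman_div (\<phi> j) ((if j = i then y else x $ j) + c *\<^sub>R v $ j) (if j = i then y else x $ j))
        - exp (b s) * \<L> (\<chi> j. if j = i then y else x $ j) (zl s))) (x $ i)
      :> exp (a s + g s) *\<^sub>R
        (grad (\<phi> i) (x $ i + c *\<^sub>R v $ i) - grad (\<phi> i) (x $ i) - c *\<^sub>R (hessian (\<phi> i) (x $ i) *v v $ i)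
          - exp (b s) *\<^sub>R D)"
    by (intro GDERIV_cmult GDERIV_diff)
  then show ?thesis
    unfolding D_def[symmetric] unfolding block_grad_def bregman_lagrangian_x_def
    by (intro grad_eqI)
      (simp add: bregman_div_separable_sum[OF twice_differentiable_GDERIV[OF td]] flip: c_def)
qed

lemma grad_bregman_dual_velocity:
  assumes "\<And>x. GDERIV \<Phi> x :> grad \<Phi> x"
  shows "grad (\<lambda>v. bregman_lagrangian_dual \<Phi> \<L> a b g zx l v s) v
    = exp (g s) *\<^sub>R (grad \<Phi> (l + exp (- a s) *\<^sub>R v) - grad \<Phi> l)"
proof -
  have "grad (\<lambda>v. bregman_lagrangian_dual \<Phi> \<L> a b g zx l v s) v
      = exp (a s + g s) *\<^sub>R (exp (- a s) *\<^sub>R (grad \<Phi> (l + exp (- a s) *\<^sub>R v) - grad \<Phi> l) + 0)"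
    unfolding bregman_lagrangian_dual_def
    by (intro grad_eqI GDERIV_cmult GDERIV_add GDERIV_const GDERIV_bregman_div_velocity assms)
  then show ?thesis
    by (simp flip: exp_add)
qed

lemma grad_bregman_dual_position:
  assumes "twice_differentiable \<Phi>" "(\<lambda>l. \<L> (zx s) l) differentiable (at l)"
  shows "grad (\<lambda>l. bregman_lagrangian_dual \<Phi> \<L> a b g zx l v s) l
    = exp (a s + g s) *\<^sub>R
        (grad \<Phi> (l + exp (- a s) *\<^sub>R v) - grad \<Phi> l - exp (- a s) *\<^sub>R (hessian \<Phi> l *v v)
          + exp (b s) *\<^sub>R grad (\<lambda>l. \<L> (zx s) l) l)"
  unfolding bregman_lagrangian_dual_def
  by (intro grad_eqI GDERIV_cmult GDERIV_add GDERIV_bregman_div_position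
      differentiable_imp_GDERIV_grad assms)

section \<open>Derivatives along curves on the time interval\<close>

text \<open>A connected set that is not a singleton has each of its points as a limit point,
  endpoints included; this makes derivatives within \<open>T\<close> unique.\<close>

lemma at_within_interval_neq_bot:
  fixes T :: "real set"
  assumes "is_interval T" "interior T \<noteq> {}" "t \<in> T"
  shows "at t within T \<noteq> bot"
proof -
  have "\<nexists>x. T = {x}"
    using assms(2) by (metis interior_singleton)
  then have "t islimpt T"
    using assms by (intro connected_imp_perfect) (auto simp: is_interval_connected_1)
  then show ?thesis
    by (simp add: trivial_limit_within)
qed

lemma C1_curve_has_vector_derivative:
  "C1_curve T q \<Longrightarrow> t \<in> T \<Longrightarrow> (q has_vector_derivative tderiv T q t) (at t within T)"
  by (simp add: C1_curve_def tderiv_def flip: vector_derivative_works)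

section \<open>Second-order and first-order equations of motion\<close>

theorem mainTheorem1:
  fixes f \<phi> :: "'k::finite \<Rightarrow> real^'n \<Rightarrow> real"
    and \<Phi> :: "real^'m \<Rightarrow> real"
    and A :: "'k \<Rightarrow> real^'n^'m" and C :: "real^'m" and \<mu> :: real
    and T :: "real set" and a b g :: "real \<Rightarrow> real"
    and x zx u :: "real \<Rightarrow> (real^'n)^'k"
    and l zl ul :: "real \<Rightarrow> real^'m"
    and \<L> :: "(real^'n)^'k \<Rightarrow> real^'m \<Rightarrow> real"
  defines "\<L> \<equiv> aug_lagrangian f A C \<mu>"
    and "zx \<equiv> \<lambda>t. x t + exp (- a t) *\<^sub>R tderiv T x t"
    and "zl \<equiv> \<lambda>t. l t + exp (- a t) *\<^sub>R tderiv T l t"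
    and "u \<equiv> \<lambda>t. \<chi> i. grad (\<phi> i) (zx t $ i)"
    and "ul \<equiv> \<lambda>t. grad \<Phi> (zl t)"
  assumes "\<And>i. convex_on UNIV (f i)" and "\<And>i. continuously_differentiable (f i)"
    and "\<mu> > 0"
    and "\<And>i. strongly_convex (\<phi> i)" and "\<And>i. twice_differentiable (\<phi> i)"
    and "strongly_convex \<Phi>" and "twice_differentiable \<Phi>"
    and "is_interval T" and "interior T \<noteq> {}"
    and "C1_curve T a" and "C1_curve T b" and "C1_curve T g"
    and "C2_curve T x" and "C2_curve T l"
    and "\<And>t. t \<in> T \<Longrightarrow> tderiv T g t = exp (a t)"
    and "\<And>t. t \<in> T \<Longrightarrow> tderiv T b t \<le> exp (a t)"
  shows
    "\<forall>t\<in>T.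
      (\<forall>i. euler_lagrange_block T
             (bregman_lagrangian_x (separable_sum \<phi>) \<L> a b g zl) x i t
           \<longleftrightarrow>
           tderiv T (tderiv T x) t $ i + (exp (a t) - tderiv T a t) *\<^sub>R (tderiv T x t $ i)
             + exp (2 * a t + b t) *\<^sub>R
                 (matrix_inv (hessian (\<phi> i) (zx t $ i)) *v block_grad i (\<lambda>y. \<L> y (zl t)) (x t))
             = 0) \<and>
      (euler_lagrange T (bregman_lagrangian_dual \<Phi> \<L> a b g zx) l t
       \<longleftrightarrow>
       tderiv T (tderiv T l) t + (exp (a t) - tderiv T a t) *\<^sub>R tderiv T l t
         - exp (2 * a t + b t) *\<^sub>R
             (matrix_inv (hessian \<Phi> (zl t)) *v grad (\<lambda>y. \<L> (zx t) y) (l t))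
         = 0) \<and>
      (\<forall>i. tderiv T (tderiv T x) t $ i + (exp (a t) - tderiv T a t) *\<^sub>R (tderiv T x t $ i)
             + exp (2 * a t + b t) *\<^sub>R
                 (matrix_inv (hessian (\<phi> i) (zx t $ i)) *v block_grad i (\<lambda>y. \<L> y (zl t)) (x t))
             = 0
           \<longrightarrow>
           ((\<lambda>s. x s $ i) has_vector_derivative
              exp (a t) *\<^sub>R (grad (fenchel_conj (\<phi> i)) (u t $ i) - x t $ i)) (at t within T) \<and>
           ((\<lambda>s. u s $ i) has_vector_derivative
              - exp (a t + b t) *\<^sub>R block_grad i (\<lambda>y. \<L> y (zl t)) (x t)) (at t within T)) \<and>
      (tderiv T (tderiv T l) t + (exp (a t) - tderiv T a t) *\<^sub>R tderiv T l t
         - exp (2 * a t + b t) *\<^sub>R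
             (matrix_inv (hessian \<Phi> (zl t)) *v grad (\<lambda>y. \<L> (zx t) y) (l t))
         = 0
       \<longrightarrow>
       (l has_vector_derivative
          exp (a t) *\<^sub>R (grad (fenchel_conj \<Phi>) (ul t) - l t)) (at t within T) \<and>
       (ul has_vector_derivative
          exp (a t + b t) *\<^sub>R grad (\<lambda>y. \<L> (zx t) y) (l t)) (at t within T))"
proof (intro ballI)
  fix t assume t: "t \<in> T"
  have \<phi>: "GDERIV (\<phi> i) y :> grad (\<phi> i) y" for i y
    by (rule twice_differentiable_GDERIV) fact
  have \<Phi>: "GDERIV \<Phi> y :> grad \<Phi> y" for y
    by (rule twice_differentiable_GDERIV) fact
  have nontriv: "at t within T \<noteq> bot"
    by (rule at_within_interval_neq_bot) fact+
  have a: "(a has_vector_derivative tderiv T a t) (at t within T)"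
    by (rule C1_curve_has_vector_derivative) fact+
  \<comment> \<open>The ideal scaling puts e^a in place of the derivative of g, as the momentum
    equation expects.\<close>
  have g: "(g has_vector_derivative exp (a t)) (at t within T)"
    using C1_curve_has_vector_derivative[OF \<open>C1_curve T g\<close> t]
      \<open>\<And>t. t \<in> T \<Longrightarrow> tderiv T g t = exp (a t)\<close>[OF t] by simp
  have x: "(x has_vector_derivative tderiv T x t) (at t within T)"
    and x': "(tderiv T x has_vector_derivative tderiv T (tderiv T x) t) (at t within T)"
    using \<open>C2_curve T x\<close> t by (simp_all add: C2_curve_def C1_curve_has_vector_derivative)
  have l: "(l has_vector_derivative tderiv T l t) (at t within T)"
    and l': "(tderiv T l has_vector_derivative tderiv T (tderiv T l) t) (at t within T)"
    using \<open>C2_curve T l\<close> t by (simp_all add: C2_curve_def C1_curve_has_vector_derivative)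
  note component = bounded_linear.has_vector_derivative[OF bounded_linear_vec_nth]
  have zx_nth: "zx s $ i = x s $ i + exp (- a s) *\<^sub>R tderiv T x s $ i" for s i
    by (simp add: zx_def)
  have \<L>_x: "(\<lambda>y. \<L> (\<chi> j. if j = i then y else x t $ j) (zl t)) differentiable (at (x t $ i))" for i
    unfolding \<L>_def using \<open>\<And>i. continuously_differentiable (f i)\<close>
    by (intro differentiable_aug_lagrangian_block) (simp add: continuously_differentiable_def)
  have \<L>_l: "(\<lambda>y. \<L> (zx t) y) differentiable (at (l t))"
    unfolding \<L>_def by (rule differentiable_aug_lagrangian_multiplier)

  \<comment> \<open>The driving vectors; the opposite signs reflect that the augmented Lagrangian
    enters the two Bregman Lagrangians with opposite signs.\<close>
  define Wx where "Wx = (\<lambda>i. exp (b t) *\<^sub>R block_grad i (\<lambda>y. \<L> y (zl t)) (x t))"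
  define Wl where "Wl = - exp (b t) *\<^sub>R grad (\<lambda>y. \<L> (zx t) y) (l t)"
  note core_x = bregman_momentum_equation[where q = "\<lambda>s. x s $ i" and v = "\<lambda>s. tderiv T x s $ i"
      and W = "Wx i" for i, OF \<open>\<And>i. strongly_convex (\<phi> i)\<close> \<open>\<And>i. twice_differentiable (\<phi> i)\<close>
      nontriv component[OF x] component[OF x'] a g, folded zx_nth]
  note core_l = bregman_momentum_equation[OF \<open>strongly_convex \<Phi>\<close> \<open>twice_differentiable \<Phi>\<close>
      nontriv l l' a g, folded zl_def]
  have exp_split: "exp (2 * a t + b t) = exp (2 * a t) * exp (b t)" "exp (a t + b t) = exp (a t) * exp (b t)"
    by (simp_all add: exp_add)

  \<comment> \<open>Linearity of the inverse Hessian moves e^b, and for the multiplier also the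
    sign, into the driving vector.\<close>
  have ODE_x: "exp (2 * a t + b t) *\<^sub>R
        (matrix_inv (hessian (\<phi> i) (zx t $ i)) *v block_grad i (\<lambda>y. \<L> y (zl t)) (x t))
      = exp (2 * a t) *\<^sub>R (matrix_inv (hessian (\<phi> i) (zx t $ i)) *v Wx i)" for i
    by (simp add: Wx_def exp_split matrix_vector_mult_scaleR)
  have ODE_l: "y - exp (2 * a t + b t) *\<^sub>R
        (matrix_inv (hessian \<Phi> (zl t)) *v grad (\<lambda>y. \<L> (zx t) y) (l t))
      = y + exp (2 * a t) *\<^sub>R (matrix_inv (hessian \<Phi> (zl t)) *v Wl)" for y
    by (simp add: Wl_def exp_split matrix_vector_mult_scaleR vec.neg)

  have EL_x: "euler_lagrange_block T (bregman_lagrangian_x (separable_sum \<phi>) \<L> a b g zl) x i t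
      \<longleftrightarrow> tderiv T (tderiv T x) t $ i + (exp (a t) - tderiv T a t) *\<^sub>R tderiv T x t $ i
        + exp (2 * a t) *\<^sub>R (matrix_inv (hessian (\<phi> i) (zx t $ i)) *v Wx i) = 0" for i
    unfolding euler_lagrange_block_def Let_def block_grad_bregman_velocity[OF \<phi>]
      block_grad_bregman_position[where \<L> = \<L> and x = "x t" and zl = zl and s = t, OF \<open>\<And>i. twice_differentiable (\<phi> i)\<close> \<L>_x]
    using core_x(1)[of i] by (simp add: zx_nth Wx_def)
  have EL_l: "euler_lagrange T (bregman_lagrangian_dual \<Phi> \<L> a b g zx) l t
      \<longleftrightarrow> tderiv T (tderiv T l) t + (exp (a t) - tderiv T a t) *\<^sub>R tderiv T l t
        + exp (2 * a t) *\<^sub>R (matrix_inv (hessian \<Phi> (zl t)) *v Wl) = 0"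
    unfolding euler_lagrange_def Let_def grad_bregman_dual_velocity[OF \<Phi>]
      grad_bregman_dual_position[where \<L> = \<L> and zx = zx and s = t, OF \<open>twice_differentiable \<Phi>\<close> \<L>_l]
    using core_l(1)[of Wl] by (simp add: zl_def Wl_def)

  \<comment> \<open>The definition of z_i solved for the velocity, e^a (z_i - x_i), with z_i
    recovered from u_i by the conjugate gradient.\<close>
  have flow_x: "((\<lambda>s. x s $ i) has_vector_derivative
      exp (a t) *\<^sub>R (grad (fenchel_conj (\<phi> i)) (u t $ i) - x t $ i)) (at t within T)" for i
    using component[OF x, of i] grad_fenchel_conj_grad[OF \<open>\<And>i. strongly_convex (\<phi> i)\<close> \<phi>]
    by (simp add: u_def zx_nth flip: exp_add)
  have flow_l: "(l has_vector_derivative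
      exp (a t) *\<^sub>R (grad (fenchel_conj \<Phi>) (ul t) - l t)) (at t within T)"
    using l grad_fenchel_conj_grad[OF \<open>strongly_convex \<Phi>\<close> \<Phi>]
    by (simp add: ul_def zl_def flip: exp_add)

  have dual_x: "((\<lambda>s. u s $ i) has_vector_derivative
      - exp (a t + b t) *\<^sub>R block_grad i (\<lambda>y. \<L> y (zl t)) (x t)) (at t within T)"
    if "tderiv T (tderiv T x) t $ i + (exp (a t) - tderiv T a t) *\<^sub>R tderiv T x t $ i
        + exp (2 * a t) *\<^sub>R (matrix_inv (hessian (\<phi> i) (zx t $ i)) *v Wx i) = 0" for i
    using core_x(2)[OF that] by (simp add: u_def Wx_def exp_split)
  have dual_l: "(ul has_vector_derivative
      exp (a t + b t) *\<^sub>R grad (\<lambda>y. \<L> (zx t) y) (l t)) (at t within T)"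
    if "tderiv T (tderiv T l) t + (exp (a t) - tderiv T a t) *\<^sub>R tderiv T l t
        + exp (2 * a t) *\<^sub>R (matrix_inv (hessian \<Phi> (zl t)) *v Wl) = 0"
    using core_l(2)[of Wl] that by (simp add: ul_def zl_def Wl_def exp_split)

  show "(\<forall>i. euler_lagrange_block T
             (bregman_lagrangian_x (separable_sum \<phi>) \<L> a b g zl) x i t
           \<longleftrightarrow>
           tderiv T (tderiv T x) t $ i + (exp (a t) - tderiv T a t) *\<^sub>R (tderiv T x t $ i)
             + exp (2 * a t + b t) *\<^sub>R
                 (matrix_inv (hessian (\<phi> i) (zx t $ i)) *v block_grad i (\<lambda>y. \<L> y (zl t)) (x t))
             = 0) \<and>
      (euler_lagrange T (bregman_lagrangian_dual \<Phi> \<L> a b g zx) l t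
       \<longleftrightarrow>
       tderiv T (tderiv T l) t + (exp (a t) - tderiv T a t) *\<^sub>R tderiv T l t
         - exp (2 * a t + b t) *\<^sub>R
             (matrix_inv (hessian \<Phi> (zl t)) *v grad (\<lambda>y. \<L> (zx t) y) (l t))
         = 0) \<and>
      (\<forall>i. tderiv T (tderiv T x) t $ i + (exp (a t) - tderiv T a t) *\<^sub>R (tderiv T x t $ i)
             + exp (2 * a t + b t) *\<^sub>R
                 (matrix_inv (hessian (\<phi> i) (zx t $ i)) *v block_grad i (\<lambda>y. \<L> y (zl t)) (x t))
             = 0
           \<longrightarrow>
           ((\<lambda>s. x s $ i) has_vector_derivative
              exp (a t) *\<^sub>R (grad (fenchel_conj (\<phi> i)) (u t $ i) - x t $ i)) (at t within T) \<and>
           ((\<lambda>s. u s $ i) has_vector_derivative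
              - exp (a t + b t) *\<^sub>R block_grad i (\<lambda>y. \<L> y (zl t)) (x t)) (at t within T)) \<and>
      (tderiv T (tderiv T l) t + (exp (a t) - tderiv T a t) *\<^sub>R tderiv T l t
         - exp (2 * a t + b t) *\<^sub>R
             (matrix_inv (hessian \<Phi> (zl t)) *v grad (\<lambda>y. \<L> (zx t) y) (l t))
         = 0
       \<longrightarrow>
       (l has_vector_derivative
          exp (a t) *\<^sub>R (grad (fenchel_conj \<Phi>) (ul t) - l t)) (at t within T) \<and>
       (ul has_vector_derivative
          exp (a t + b t) *\<^sub>R grad (\<lambda>y. \<L> (zx t) y) (l t)) (at t within T))"
    unfolding ODE_x ODE_l
    by (intro conjI allI impI EL_x EL_l flow_x flow_l dual_x dual_l)
qed

end
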